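(* Let $q$ be a power of a prime $p$, let $n\ge 1$, $\tau=p^{\nu_p(n)}$, and let $x^n-1=f_1^\tau f_2^\tau\cdots f_r^\tau$ with $f_1,\ldots,f_r\in\mathbb{F}_q[x]$ distinct monic irreducible polynomials. Let $\alpha\in\mathbb{F}_{q^n}$ be a normal element over $\mathbb{F}_q$ and let $b$ be a positive integer with $b\le p$. Let $\beta\in\mathbb{F}_{q^n}$ with $g(x)=\phi_\alpha^{-1}(\beta)$ and let $g_i=g\bmod f_i^\tau$ for $1\le i\le r$. Then the following are equivalent: 1. $\beta$ is $(\alpha,b)$-sociable; 2. $\gcd(x^n-1,\,g(x)-cx^j)=1$ for all $j\in\{0,\ldots,n-1\}$ and $c\in\{0,\ldots,b-1\}$; 3. $\gcd(f_i,\,g_i-cx^j)=1$ for all $i\in\{1,\ldots,r\}$, $j\in\{0,\ldots,n-1\}$ and $c\in\{0,\ldots,b-1\}$; 4. $g(\theta)\notin\{c\theta^j : c\in\{0,\ldots,b-1\},\ j\in\{0,\ldots,n-1\}\}$ for every root $\theta$ of $x^n-1$ (in an algebraic closure of $\mathbb{F}_q$).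
   Context: $\nu_p(n)$ is the largest integer $e$ such that $p^e$ divides $n$. Integers $c\in\{0,\ldots,b-1\}$ are viewed in $\mathbb{F}_p\subseteq\mathbb{F}_q$. An element $\alpha\in\mathbb{F}_{q^n}$ is normal (over $\mathbb{F}_q$) if $\alpha,\alpha^q,\ldots,\alpha^{q^{n-1}}$ are linearly independent over $\mathbb{F}_q$. For $f=\sum_i a_ix^i\in\mathbb{F}_q[x]$ put $f\circ\alpha=\sum_i a_i\alpha^{q^i}$, and for a normal $\alpha$ define $\phi_\alpha(f)=f\circ\alpha$; this induces an $\mathbb{F}_q$-linear isomorphism $\mathbb{F}_q[x]/(x^n-1)\to\mathbb{F}_{q^n}$, also denoted $\phi_\alpha$, and $\phi_\alpha^{-1}(\beta)$ is identified with any polynomial representative (e.g. the one of degree less than $n$). For a positive integer $b\le p$, an element $\beta\in\mathbb{F}_{q^n}$ has normal $\alpha$-depth $b$ if $\beta,\beta-\alpha,\ldots,\beta-(b-1)\alpha$ are all normal over $\mathbb{F}_q$. The element $\beta$ is $(\alpha,b)$-sociable if $\beta^{q^i}$ has normal $\alpha$-depth $b$ for all $i\ge 0$. *)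

theory Defs
  imports
    "HOL-Computational_Algebra.Computational_Algebra"
    "HOL-Algebra.Algebraic_Closure_Type"
    "HOL-Library.Cardinality"
begin

text \<open>
  The fields \<open>F_q\<close> and \<open>F_{q^n}\<close> are types \<open>'k\<close> and \<open>'l\<close> with \<open>q\<close> and \<open>q^n\<close> elements, and
  \<open>F_q\<close> is included in \<open>F_{q^n}\<close> through an arbitrary field homomorphism \<open>emb\<close>.
\<close>

definition field_embedding :: "('k::field \<Rightarrow> 'l::field) \<Rightarrow> bool" where
  "field_embedding emb \<longleftrightarrow>
     emb 1 = 1 \<and>
     (\<forall>x y. emb (x + y) = emb x + emb y) \<and>
     (\<forall>x y. emb (x * y) = emb x * emb y)"

text \<open>
  Independence is that of the family of conjugates (indexed by \<open>i < n\<close>), not of the set of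
  conjugates, which may have fewer than \<open>n\<close> elements.
\<close>

definition normal_element :: "('k::{field,finite} \<Rightarrow> 'l::field) \<Rightarrow> nat \<Rightarrow> 'l \<Rightarrow> bool" where
  "normal_element emb n \<alpha> \<longleftrightarrow>
     (\<forall>a :: nat \<Rightarrow> 'k. (\<Sum>i<n. emb (a i) * \<alpha> ^ (CARD('k) ^ i)) = 0 \<longrightarrow> (\<forall>i<n. a i = 0))"

definition phi :: "('k::{field,finite} \<Rightarrow> 'l::field) \<Rightarrow> 'l \<Rightarrow> 'k poly \<Rightarrow> 'l" where
  "phi emb \<alpha> f = (\<Sum>i\<le>degree f. emb (coeff f i) * \<alpha> ^ (CARD('k) ^ i))"

definition normal_depth ::
    "('k::{field,finite} \<Rightarrow> 'l::field) \<Rightarrow> nat \<Rightarrow> 'l \<Rightarrow> nat \<Rightarrow> 'l \<Rightarrow> bool" where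
  "normal_depth emb n \<alpha> b \<beta> \<longleftrightarrow> (\<forall>c<b. normal_element emb n (\<beta> - of_nat c * \<alpha>))"

definition sociable ::
    "('k::{field,finite} \<Rightarrow> 'l::field) \<Rightarrow> nat \<Rightarrow> 'l \<Rightarrow> nat \<Rightarrow> 'l \<Rightarrow> bool" where
  "sociable emb n \<alpha> b \<beta> \<longleftrightarrow> (\<forall>i. normal_depth emb n \<alpha> b (\<beta> ^ (CARD('k) ^ i)))"

end

theory Submission
  imports Defs "HOL-Number_Theory.Residues"
begin

text \<open>
  All four conditions are compared with the fourth one, which speaks about values at the roots
  \<open>\<theta>\<close> of \<open>x^n - 1\<close>, that is at the \<open>\<theta>\<close> with \<open>\<theta>^n = 1\<close>.

  Two polynomials over a field are coprime exactly if they have no common root in the algebraic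
  closure (\<open>coprime_iff_no_common_root\<close>). This turns the second condition into the fourth one
  directly. It does the same for the third one: the roots of \<open>x^n - 1\<close> are the roots of the
  \<open>f\<^sub>i\<close>, and reducing \<open>g\<close> modulo \<open>f\<^sub>i^\<tau>\<close> does not change its value at a root of \<open>f\<^sub>i\<close>.

  For the first condition, the point is that \<open>f \<mapsto> f \<circ> \<alpha>\<close> turns multiplication of polynomials into
  composition, \<open>h \<circ> (f \<circ> \<alpha>) = (h f) \<circ> \<alpha>\<close> (\<open>phi_phi\<close>), so that for normal \<open>\<alpha>\<close> the annihilator of
  \<open>f \<circ> \<alpha>\<close> consists of the \<open>h\<close> with \<open>x^n - 1\<close> dividing \<open>h f\<close>. As an element is normal exactly if its
  annihilator contains no nonzero polynomial of degree below \<open>n\<close>, the element \<open>f \<circ> \<alpha>\<close> is normal exactly if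
  \<open>f\<close> is coprime to \<open>x^n - 1\<close> (\<open>normal_phi_iff_coprime\<close>).
  Now \<open>\<beta>^(q^i) - c \<alpha> = (x^i g - c) \<circ> \<alpha>\<close>, so sociability says that \<open>\<theta>^i g(\<theta>) \<noteq> c\<close> for all
  roots \<open>\<theta>\<close>, all \<open>i\<close> and all \<open>c < b\<close>. Multiplying by the inverse power
  \<open>\<theta>^j = \<theta>^(-i)\<close> with \<open>j < n\<close>, one arrives at the fourth condition.
\<close>

section \<open>Coprimality of polynomials and common roots\<close>

text \<open>
  A nonzero element of least degree in the ideal generated by \<open>f\<close> and \<open>g\<close> divides both of them,
  since the remainders of \<open>f\<close> and \<open>g\<close> modulo it lie in the ideal as well. Hence it is a unit.
\<close>

lemma coprime_poly_bezout:
  fixes f g :: "'a::field poly"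
  assumes "coprime f g"
  shows "\<exists>u v. u * f + v * g = 1"
proof -
  define I where "I = {h. \<exists>u v. h = u * f + v * g}"
  have in_I: "f \<in> I" "g \<in> I"
    unfolding I_def by (auto intro: exI[of _ 1] exI[of _ 0])
  have scale_I: "w * h \<in> I" if h: "h \<in> I" for w h
  proof -
    obtain u v where "h = u * f + v * g"
      using h unfolding I_def by blast
    then have "w * h = (w * u) * f + (w * v) * g"
      by (simp add: algebra_simps)
    then show ?thesis
      unfolding I_def by blast
  qed
  have diff_I: "h - h' \<in> I" if hs: "h \<in> I" "h' \<in> I" for h h'
  proof -
    obtain u v u' v' where "h = u * f + v * g" "h' = u' * f + v' * g"
      using hs unfolding I_def by blast
    then have "h - h' = (u - u') * f + (v - v') * g"
      by (simp add: algebra_simps)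
    then show ?thesis
      unfolding I_def by blast
  qed
  have "f \<noteq> 0 \<or> g \<noteq> 0"
    using assms by auto
  then have "\<exists>h. h \<in> I \<and> h \<noteq> 0"
    using in_I by blast
  then obtain d where d: "d \<in> I" "d \<noteq> 0"
    and least: "\<And>h. h \<in> I \<Longrightarrow> h \<noteq> 0 \<Longrightarrow> degree d \<le> degree h"
    using ex_has_least_nat[of "\<lambda>h. h \<in> I \<and> h \<noteq> 0" _ degree] by blast
  have d_dvd: "d dvd h" if "h \<in> I" for h
  proof -
    have "h mod d \<in> I"
      using diff_I[OF that scale_I[OF d(1)], of "h div d"] by (simp add: minus_div_mult_eq_mod)
    then have "h mod d = 0"
      using least[of "h mod d"] degree_mod_less'[of d h] d(2) by fastforce
    then show ?thesis
      by auto
  qed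
  have "d dvd 1"
    using assms d_dvd in_I by (meson coprime_common_divisor)
  then obtain e where "1 = d * e"
    by (auto elim: dvdE)
  then have "1 \<in> I"
    using scale_I[OF d(1), of e] by (simp add: mult.commute)
  then show ?thesis
    unfolding I_def by (auto dest: sym)
qed

definition eval_ac :: "'a::field alg_closure \<Rightarrow> 'a poly \<Rightarrow> 'a alg_closure" where
  "eval_ac \<theta> h = poly (map_poly to_ac h) \<theta>"

lemma eval_ac_0 [simp]: "eval_ac \<theta> 0 = 0"
  by (simp add: eval_ac_def)

lemma eval_ac_1 [simp]: "eval_ac \<theta> 1 = 1"
  by (simp add: eval_ac_def)

lemma eval_ac_monom [simp]: "eval_ac \<theta> (monom c j) = to_ac c * \<theta> ^ j"
  by (simp add: eval_ac_def map_poly_monom poly_monom)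

lemma eval_ac_pCons [simp]: "eval_ac \<theta> (pCons a h) = to_ac a + \<theta> * eval_ac \<theta> h"
  by (cases "a = 0 \<and> h = 0") (auto simp: eval_ac_def map_poly_pCons)

lemma eval_ac_add [simp]: "eval_ac \<theta> (h + h') = eval_ac \<theta> h + eval_ac \<theta> h'"
proof -
  have "map_poly to_ac (h + h') = map_poly to_ac h + map_poly to_ac h'"
    by (rule poly_eqI) (simp add: coeff_map_poly)
  then show ?thesis
    by (simp add: eval_ac_def)
qed

lemma eval_ac_diff [simp]: "eval_ac \<theta> (h - h') = eval_ac \<theta> h - eval_ac \<theta> h'"
  using eval_ac_add[of \<theta> "h - h'" h'] by simp

lemma eval_ac_smult [simp]: "eval_ac \<theta> (smult c h) = to_ac c * eval_ac \<theta> h"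
  by (simp add: eval_ac_def map_poly_smult)

lemma eval_ac_mult [simp]: "eval_ac \<theta> (h * h') = eval_ac \<theta> h * eval_ac \<theta> h'"
  by (induction h) (simp_all add: algebra_simps)

lemma eval_ac_power [simp]: "eval_ac \<theta> (h ^ m) = eval_ac \<theta> h ^ m"
  by (induction m) simp_all

lemma eval_ac_prod: "eval_ac \<theta> (prod h A) = (\<Prod>x\<in>A. eval_ac \<theta> (h x))"
  by (induction A rule: infinite_finite_induct) simp_all

lemma eval_ac_eq_0_of_dvd: "h dvd h' \<Longrightarrow> eval_ac \<theta> h = 0 \<Longrightarrow> eval_ac \<theta> h' = 0"
  by (auto elim: dvdE)

lemma nonunit_has_root_ac:
  fixes d :: "'a::field poly"
  assumes "\<not> is_unit d"
  shows "\<exists>\<theta>. eval_ac \<theta> d = 0"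
proof (cases "d = 0")
  case False
  then have "degree d > 0"
    using assms by (simp add: is_unit_iff_degree)
  then have "degree (map_poly to_ac d) > 0"
    by (simp add: degree_map_poly)
  then show ?thesis
    unfolding eval_ac_def by (rule alg_closed_imp_poly_has_root)
qed simp

lemma coprime_iff_no_common_root:
  fixes f g :: "'a::field poly"
  shows "coprime f g \<longleftrightarrow> (\<forall>\<theta>. eval_ac \<theta> f = 0 \<longrightarrow> eval_ac \<theta> g \<noteq> 0)"
proof
  assume "coprime f g"
  then obtain u v where uv: "u * f + v * g = 1"
    using coprime_poly_bezout by blast
  show "\<forall>\<theta>. eval_ac \<theta> f = 0 \<longrightarrow> eval_ac \<theta> g \<noteq> 0"
  proof (intro allI impI notI)
    fix \<theta> assume "eval_ac \<theta> f = 0" "eval_ac \<theta> g = 0"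
    then have "eval_ac \<theta> (u * f + v * g) = 0"
      by simp
    then show False
      by (simp add: uv)
  qed
next
  assume no_root: "\<forall>\<theta>. eval_ac \<theta> f = 0 \<longrightarrow> eval_ac \<theta> g \<noteq> 0"
  show "coprime f g"
  proof (rule coprimeI, rule ccontr)
    fix d assume d: "d dvd f" "d dvd g" "\<not> is_unit d"
    then obtain \<theta> where "eval_ac \<theta> d = 0"
      using nonunit_has_root_ac by blast
    then show False
      using no_root eval_ac_eq_0_of_dvd d(1,2) by blast
  qed
qed

lemma root_of_unity_iff: "eval_ac \<theta> (monom 1 n - 1) = 0 \<longleftrightarrow> \<theta> ^ n = 1"
  by simp

section \<open>Powers in a finite field\<close>

text \<open>
  Multiplication by \<open>x \<noteq> 0\<close> permutes the nonzero elements, so it does not change their product.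
\<close>

lemma power_card_field_eq:
  fixes x :: "'a::{field,finite}"
  shows "x ^ CARD('a) = x"
proof (cases "x = 0")
  case False
  let ?P = "\<Prod>y\<in>-{0::'a}. y"
  have "(\<Prod>y\<in>-{0}. x * y) = ?P"
    by (rule prod.reindex_bij_witness[of _ "\<lambda>y. y / x" "\<lambda>y. x * y"]) (use False in auto)
  then have "x ^ card (-{0::'a}) * ?P = ?P"
    by (simp add: prod.distrib)
  moreover have "?P \<noteq> 0"
    by simp
  ultimately have "x ^ card (-{0::'a}) = 1"
    by simp
  moreover have "CARD('a) = Suc (card (-{0::'a}))"
    using card.remove[of "UNIV :: 'a set" 0] by (simp add: Compl_eq_Diff_UNIV)
  ultimately show ?thesis
    by simp
qed (simp add: power_0_left)

lemma CHAR_eq_of_card_prime_power: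
  assumes "prime p" and "CARD('a::{field,finite}) = p ^ m"
  shows "CHAR('a) = p"
proof -
  have prime_char: "prime CHAR('a)"
    by (intro prime_CHAR_semidom finite_imp_CHAR_pos) simp
  have "CHAR('a) dvd p ^ m"
    using CHAR_dvd_CARD[where 'a = 'a] assms(2) by simp
  then have "CHAR('a) dvd p"
    using prime_char prime_dvd_power by blast
  then show ?thesis
    using prime_char assms(1) primes_dvd_imp_eq by blast
qed

section \<open>The action of polynomials on a finite extension\<close>

locale finite_field_extension =
  fixes emb :: "'k::{field,finite} \<Rightarrow> 'l::{field,finite}" and p k n :: nat
  assumes prime_p: "prime p"
    and card_base: "CARD('k) = p ^ k"
    and card_ext: "CARD('l) = CARD('k) ^ n"
    and n_pos: "n > 0"
    and embedding: "field_embedding emb"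
begin

lemma emb_1: "emb 1 = 1" and emb_add: "emb (x + y) = emb x + emb y"
  and emb_mult: "emb (x * y) = emb x * emb y"
  using embedding unfolding field_embedding_def by auto

lemma emb_0 [simp]: "emb 0 = 0"
  using emb_add[of 0 0] by (simp only: add_0_left add_cancel_right_right)

lemma emb_of_nat: "emb (of_nat c) = of_nat c"
  by (induction c) (simp_all add: emb_add emb_1)

lemma emb_power: "emb (x ^ m) = emb x ^ m"
  by (induction m) (simp_all add: emb_mult emb_1)

lemma frobenius_emb: "emb a ^ CARD('k) = emb a"
  by (simp flip: emb_power add: power_card_field_eq)

lemma frobenius_add: "(x + y :: 'l) ^ CARD('k) = x ^ CARD('k) + y ^ CARD('k)"
proof -
  have "CARD('l) = p ^ (k * n)"
    by (simp add: card_ext card_base power_mult)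
  then have "CHAR('l) = p"
    by (rule CHAR_eq_of_card_prime_power[OF prime_p])
  then show ?thesis
    using freshmans_dream'[of "CARD('k)" k x y] prime_p card_base by simp
qed

lemma phi_0 [simp]: "phi emb \<alpha> 0 = 0"
  by (simp add: phi_def)

lemma phi_at_0: "phi emb 0 f = 0"
  by (simp add: phi_def power_0_left)

lemma phi_eq_sum:
  assumes "degree f < m"
  shows "phi emb \<alpha> f = (\<Sum>i<m. emb (coeff f i) * \<alpha> ^ (CARD('k) ^ i))"
  unfolding phi_def using assms
  by (intro sum.mono_neutral_left) (auto simp: coeff_eq_0)

lemma phi_add: "phi emb \<alpha> (f + g) = phi emb \<alpha> f + phi emb \<alpha> g"
proof -
  let ?m = "Suc (max (degree f) (degree g))"
  have "degree (f + g) < ?m" "degree f < ?m" "degree g < ?m"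
    using degree_add_le_max[of f g] by auto
  then show ?thesis
    by (simp only: phi_eq_sum[of _ ?m] coeff_add emb_add distrib_right sum.distrib)
qed

lemma phi_diff: "phi emb \<alpha> (f - g) = phi emb \<alpha> f - phi emb \<alpha> g"
  using phi_add[of \<alpha> "f - g" g] by simp

lemma phi_smult: "phi emb \<alpha> (smult a f) = emb a * phi emb \<alpha> f"
proof -
  have "degree (smult a f) < Suc (degree f)" "degree f < Suc (degree f)"
    using degree_smult_le[of a f] by auto
  then show ?thesis
    by (simp only: phi_eq_sum[of _ "Suc (degree f)"] coeff_smult emb_mult mult.assoc
        sum_distrib_left)
qed

lemma phi_monom: "phi emb \<alpha> (monom a j) = emb a * \<alpha> ^ (CARD('k) ^ j)"
proof -
  have "degree (monom a j) < Suc j"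
    using degree_monom_le[of a j] by simp
  then show ?thesis
    by (subst phi_eq_sum[of _ "Suc j"]) (simp_all add: sum.neutral)
qed

lemma frobenius_sum: "(\<Sum>i\<in>A. h i :: 'l) ^ CARD('k) = (\<Sum>i\<in>A. h i ^ CARD('k))"
  by (induction A rule: infinite_finite_induct) (simp_all add: frobenius_add power_0_left)

text \<open>
  Multiplying by \<open>x\<close> amounts to applying the Frobenius map, which is additive and fixes the
  coefficients.
\<close>

lemma phi_pCons_0: "phi emb \<alpha> (pCons 0 f) = phi emb \<alpha> f ^ CARD('k)"
proof -
  let ?m = "Suc (degree f)"
  have "degree (pCons 0 f) < Suc ?m"
    using degree_pCons_le[of 0 f] by simp
  then have "phi emb \<alpha> (pCons 0 f)
      = (\<Sum>i<Suc ?m. emb (coeff (pCons 0 f) i) * \<alpha> ^ (CARD('k) ^ i))"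
    by (rule phi_eq_sum)
  also have "\<dots> = (\<Sum>i<?m. emb (coeff f i) * \<alpha> ^ (CARD('k) ^ Suc i))"
    by (simp only: sum.lessThan_Suc_shift[of _ ?m] coeff_pCons_0 coeff_pCons_Suc emb_0
        mult_zero_left add_0_left)
  also have "\<dots> = (\<Sum>i<?m. (emb (coeff f i) * \<alpha> ^ (CARD('k) ^ i)) ^ CARD('k))"
    by (simp add: power_mult_distrib frobenius_emb mult.commute flip: power_mult)
  also have "\<dots> = phi emb \<alpha> f ^ CARD('k)"
    by (simp only: phi_eq_sum[of f ?m] frobenius_sum lessI)
  finally show ?thesis .
qed

lemma phi_pCons: "phi emb \<alpha> (pCons a f) = emb a * \<alpha> + phi emb \<alpha> f ^ CARD('k)"
proof -
  have "pCons a f = monom a 0 + pCons 0 f"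
    by (simp add: monom_0)
  then show ?thesis
    by (simp only: phi_add phi_monom phi_pCons_0) simp
qed

lemma phi_monom_mult: "phi emb \<alpha> (monom 1 i * g) = phi emb \<alpha> g ^ (CARD('k) ^ i)"
  by (induction i) (simp_all add: monom_0 monom_Suc phi_pCons_0 mult.commute flip: power_mult)

lemma phi_phi: "phi emb (phi emb \<alpha> f) h = phi emb \<alpha> (h * f)"
  by (induction h) (simp_all add: phi_pCons phi_add phi_smult)

section \<open>Normal elements\<close>

lemma normal_element_iff_phi:
  "normal_element emb n \<beta> \<longleftrightarrow> (\<forall>h. degree h < n \<longrightarrow> phi emb \<beta> h = 0 \<longrightarrow> h = 0)"
proof
  assume normal: "normal_element emb n \<beta>"
  show "\<forall>h. degree h < n \<longrightarrow> phi emb \<beta> h = 0 \<longrightarrow> h = 0"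
  proof (intro allI impI)
    fix h assume h: "degree h < n" "phi emb \<beta> h = 0"
    then have "\<forall>i<n. coeff h i = 0"
      using normal unfolding normal_element_def by (metis phi_eq_sum)
    then have "lead_coeff h = 0"
      using h(1) by blast
    then show "h = 0"
      by simp
  qed
next
  assume inj: "\<forall>h. degree h < n \<longrightarrow> phi emb \<beta> h = 0 \<longrightarrow> h = 0"
  show "normal_element emb n \<beta>"
    unfolding normal_element_def
  proof (intro allI impI)
    fix a :: "nat \<Rightarrow> 'k" and i
    assume sum0: "(\<Sum>i<n. emb (a i) * \<beta> ^ (CARD('k) ^ i)) = 0" and "i < n"
    define h where "h = (\<Sum>j<n. monom (a j) j)"
    have coeff_h: "coeff h j = (if j < n then a j else 0)" for j
      by (simp add: h_def coeff_sum)
    have "degree h < n"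
      using n_pos by (intro degree_lessI) (auto simp: coeff_h)
    moreover from this have "phi emb \<beta> h = 0"
      by (simp add: phi_eq_sum coeff_h sum0)
    ultimately have "h = 0"
      using inj by blast
    then show "a i = 0"
      using coeff_h[of i] \<open>i < n\<close> by simp
  qed
qed

lemma degree_x_pow_minus_1: "degree (monom 1 n - 1 :: 'k poly) = n"
  using degree_add_eq_left[of "-1" "monom 1 n :: 'k poly"] n_pos by (simp add: degree_monom_eq)

lemma x_pow_minus_1_nonzero: "monom 1 n - 1 \<noteq> (0 :: 'k poly)"
  using degree_x_pow_minus_1 n_pos by fastforce

text \<open>
  The polynomial \<open>x^n - 1\<close> annihilates every element, because \<open>\<alpha>^(q^n) = \<alpha>\<close>; normality says that
  no nonzero remainder modulo \<open>x^n - 1\<close> annihilates \<open>\<alpha>\<close>.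
\<close>

lemma phi_eq_0_iff_dvd:
  assumes "normal_element emb n \<alpha>"
  shows "phi emb \<alpha> h = 0 \<longleftrightarrow> monom 1 n - 1 dvd h"
proof -
  let ?X = "monom 1 n - 1 :: 'k poly"
  have "phi emb \<alpha> ?X = \<alpha> ^ (CARD('k) ^ n) - \<alpha> ^ (CARD('k) ^ 0)"
    by (simp only: phi_diff phi_monom emb_1 mult_1_left flip: monom_eq_1)
  also have "\<dots> = 0"
    using power_card_field_eq[of \<alpha>] by (simp add: card_ext)
  finally have "phi emb \<alpha> (w * ?X) = 0" for w
    by (simp only: phi_at_0 flip: phi_phi)
  then have "phi emb \<alpha> h = phi emb \<alpha> (h mod ?X)"
    using phi_add[of \<alpha> "h div ?X * ?X" "h mod ?X"]
    by (simp only: div_mult_mod_eq add_0_left)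
  moreover have "phi emb \<alpha> (h mod ?X) = 0 \<longleftrightarrow> h mod ?X = 0"
  proof
    have "degree (h mod ?X) < n"
      using degree_mod_less[OF x_pow_minus_1_nonzero, of h] degree_x_pow_minus_1 n_pos by auto
    then show "phi emb \<alpha> (h mod ?X) = 0 \<Longrightarrow> h mod ?X = 0"
      using assms normal_element_iff_phi by blast
  qed simp
  ultimately show ?thesis
    by (simp add: dvd_eq_mod_eq_0)
qed

text \<open>
  If \<open>x^n - 1 = d e\<close> with a common divisor \<open>d\<close> of positive degree, then \<open>e\<close> annihilates
  \<open>f \<circ> \<alpha>\<close> although its degree is below \<open>n\<close>; if there is no such \<open>d\<close>, then \<open>x^n - 1\<close> divides \<open>h f\<close>
  only if it divides \<open>h\<close>.
\<close>

lemma normal_phi_iff_coprime: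
  assumes normal: "normal_element emb n \<alpha>"
  shows "normal_element emb n (phi emb \<alpha> f) \<longleftrightarrow> coprime (monom 1 n - 1) f"
proof -
  let ?X = "monom 1 n - 1 :: 'k poly"
  have annihilates_iff: "phi emb (phi emb \<alpha> f) h = 0 \<longleftrightarrow> ?X dvd h * f" for h
    by (simp add: phi_phi phi_eq_0_iff_dvd[OF normal])
  show ?thesis
  proof
    assume normal_f: "normal_element emb n (phi emb \<alpha> f)"
    show "coprime ?X f"
    proof (rule coprimeI, rule ccontr)
      fix d assume d: "d dvd ?X" "d dvd f" "\<not> is_unit d"
      obtain e where e: "?X = d * e"
        using d(1) by (auto elim: dvdE)
      then have nonzero: "d \<noteq> 0" "e \<noteq> 0"
        using x_pow_minus_1_nonzero by auto
      have "degree d > 0"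
        using d(3) nonzero(1) by (simp add: is_unit_iff_degree)
      then have "degree e < n"
        using degree_mult_eq[OF nonzero] degree_x_pow_minus_1 e by simp
      moreover have "?X dvd e * f"
        unfolding e using d(2) by (simp add: mult.commute mult_dvd_mono)
      ultimately show False
        using normal_f nonzero(2) by (simp add: normal_element_iff_phi annihilates_iff)
    qed
  next
    assume "coprime ?X f"
    then obtain u v where uv: "u * ?X + v * f = 1"
      using coprime_poly_bezout by blast
    show "normal_element emb n (phi emb \<alpha> f)"
      unfolding normal_element_iff_phi annihilates_iff
    proof (intro allI impI)
      fix h assume h: "degree h < n" "?X dvd h * f"
      have h_eq: "h * u * ?X + v * (h * f) = h"
        using arg_cong[OF uv, of "\<lambda>t. h * t"] by (simp add: algebra_simps)
      have "?X dvd h * u * ?X + v * (h * f)"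
        using h(2) by (intro dvd_add) simp_all
      then have "?X dvd h"
        by (simp only: h_eq)
      then show "h = 0"
        using h(1) by (metis degree_x_pow_minus_1 dvd_imp_degree_le not_le)
    qed
  qed
qed

text \<open>
  The elements whose normality is required are \<open>\<beta>^(q^i) - c \<alpha> = (x^i g - c) \<circ> \<alpha>\<close>. The exponent \<open>i\<close>
  stands on the side of \<open>g\<close> here and ranges over all natural numbers.
\<close>

lemma sociable_iff_roots:
  assumes normal: "normal_element emb n \<alpha>"
  shows "sociable emb n \<alpha> b (phi emb \<alpha> g) \<longleftrightarrow>
    (\<forall>i. \<forall>c<b. \<forall>\<theta>. \<theta> ^ n = 1 \<longrightarrow> \<theta> ^ i * eval_ac \<theta> g \<noteq> of_nat c)"
proof -
  have "phi emb \<alpha> g ^ (CARD('k) ^ i) - of_nat c * \<alpha>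
      = phi emb \<alpha> (monom 1 i * g - monom (of_nat c) 0)" for i c
    by (simp add: phi_diff phi_monom_mult phi_monom emb_of_nat)
  then show ?thesis
    by (simp add: sociable_def normal_depth_def normal_phi_iff_coprime[OF normal]
        coprime_iff_no_common_root)
qed

end

section \<open>Reduction modulo a factor, and powers of roots of unity\<close>

lemma eval_ac_mod:
  assumes "eval_ac \<theta> h = 0"
  shows "eval_ac \<theta> (g mod h) = eval_ac \<theta> g"
proof -
  have "eval_ac \<theta> g = eval_ac \<theta> (g div h * h + g mod h)"
    by simp
  also have "\<dots> = eval_ac \<theta> (g mod h)"
    unfolding eval_ac_add eval_ac_mult assms by simp
  finally show ?thesis ..
qed

lemma eval_ac_prod_power_eq_0_iff:
  assumes "finite A" and "m > 0"
  shows "eval_ac \<theta> (\<Prod>i\<in>A. f i ^ m) = 0 \<longleftrightarrow> (\<exists>i\<in>A. eval_ac \<theta> (f i) = 0)"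
  using assms by (simp add: eval_ac_prod)

text \<open>
  At an \<open>n\<close>-th root of unity all powers of \<open>\<theta>\<close>, in particular the inverses of powers, are powers
  with exponent below \<open>n\<close>.
\<close>

lemma root_of_unity_power_mult_eq_iff:
  fixes \<theta> y z :: "'a::field"
  assumes "n > 0" and "\<theta> ^ n = 1"
  shows "(\<exists>i. \<theta> ^ i * y = z) \<longleftrightarrow> (\<exists>j<n. y = z * \<theta> ^ j)"
proof
  assume "\<exists>i. \<theta> ^ i * y = z"
  then obtain i where i: "\<theta> ^ i * y = z" ..
  \<comment> \<open>The outer \<open>mod\<close> matters if \<open>n\<close> divides \<open>i\<close>, where \<open>n - i mod n\<close> is not below \<open>n\<close>.\<close>
  let ?j = "(n - i mod n) mod n"
  have "(?j + i) mod n = ((n - i mod n) + i mod n) mod n"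
    by (simp only: mod_add_left_eq mod_add_right_eq)
  also have "\<dots> = 0"
    using assms(1) by (simp add: less_imp_le)
  finally obtain m where "?j + i = n * m"
    by (auto elim: dvdE)
  then have "\<theta> ^ ?j * \<theta> ^ i = 1"
    by (simp add: power_mult assms(2) flip: power_add)
  then have "y = z * \<theta> ^ ?j"
    by (metis i mult.assoc mult.commute mult_1)
  then show "\<exists>j<n. y = z * \<theta> ^ j"
    using assms(1) mod_less_divisor by blast
next
  assume "\<exists>j<n. y = z * \<theta> ^ j"
  then obtain j where j: "j < n" "y = z * \<theta> ^ j"
    by blast
  have "\<theta> ^ (n - j) * \<theta> ^ j = 1"
    using j(1) assms(2) by (simp flip: power_add)
  then have "\<theta> ^ (n - j) * y = z"
    by (simp add: j(2) mult.left_commute)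
  then show "\<exists>i. \<theta> ^ i * y = z" ..
qed

section \<open>The characterisations of sociable elements\<close>

theorem theorem2:
  fixes p k q n b r \<tau> :: nat
    and emb :: "'k::{field,finite} \<Rightarrow> 'l::{field,finite}"
    and f :: "nat \<Rightarrow> 'k poly" and g :: "'k poly"
    and \<alpha> \<beta> :: 'l
  assumes "prime p" and "k \<ge> 1" and "q = p ^ k"
    and "n \<ge> 1"
    and "CARD('k) = q" and "CARD('l) = q ^ n" and "field_embedding emb"
    and "\<tau> = p ^ multiplicity p n"
    and "monom 1 n - 1 = (\<Prod>i=1..r. f i ^ \<tau>)"
    and "inj_on f {1..r}"
    and "\<And>i. i \<in> {1..r} \<Longrightarrow> lead_coeff (f i) = 1 \<and> irreducible (f i)"
    and "normal_element emb n \<alpha>"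
    and "1 \<le> b" and "b \<le> p"
    and "phi emb \<alpha> g = \<beta>"
  shows
    "let S1 = sociable emb n \<alpha> b \<beta>;
         S2 = (\<forall>j<n. \<forall>c<b. coprime (monom 1 n - 1) (g - monom (of_nat c) j));
         S3 = (\<forall>i\<in>{1..r}. \<forall>j<n. \<forall>c<b.
                 coprime (f i) (g mod f i ^ \<tau> - monom (of_nat c) j));
         S4 = (\<forall>\<theta> :: 'k alg_closure. poly (map_poly to_ac (monom 1 n - 1)) \<theta> = 0 \<longrightarrow>
                 poly (map_poly to_ac g) \<theta> \<notin> {of_nat c * \<theta> ^ j | c j. c < b \<and> j < n})
     in (S1 \<longleftrightarrow> S2) \<and> (S2 \<longleftrightarrow> S3) \<and> (S3 \<longleftrightarrow> S4)"
proof -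
  interpret finite_field_extension emb p k n
    using assms(1-7) by unfold_locales auto
  let ?X = "monom 1 n - 1 :: 'k poly"
  \<comment> \<open>Each condition is shown to say that \<open>?avoid \<theta>\<close> holds at all roots \<open>\<theta>\<close> of \<open>?X\<close>.\<close>
  let ?avoid = "\<lambda>\<theta> :: 'k alg_closure. \<forall>j<n. \<forall>c<b. eval_ac \<theta> g \<noteq> of_nat c * \<theta> ^ j"
  have tau_pos: "\<tau> > 0"
    using assms(1,8) by (simp add: prime_gt_0_nat)
  have S1: "sociable emb n \<alpha> b \<beta> \<longleftrightarrow> (\<forall>\<theta>. eval_ac \<theta> ?X = 0 \<longrightarrow> ?avoid \<theta>)"
  proof -
    have "sociable emb n \<alpha> b \<beta> \<longleftrightarrow>
        (\<forall>\<theta>. \<theta> ^ n = 1 \<longrightarrow> (\<forall>c<b. \<not> (\<exists>i. \<theta> ^ i * eval_ac \<theta> g = of_nat c)))"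
      using sociable_iff_roots[OF assms(12), of b g] unfolding assms(15) by blast
    also have "\<dots> \<longleftrightarrow> (\<forall>\<theta>. \<theta> ^ n = 1 \<longrightarrow> ?avoid \<theta>)"
      using root_of_unity_power_mult_eq_iff[OF n_pos] by blast
    finally show ?thesis
      by (simp only: root_of_unity_iff)
  qed
  have S2: "(\<forall>j<n. \<forall>c<b. coprime ?X (g - monom (of_nat c) j)) \<longleftrightarrow>
      (\<forall>\<theta>. eval_ac \<theta> ?X = 0 \<longrightarrow> ?avoid \<theta>)"
    unfolding coprime_iff_no_common_root by auto
  have S3: "(\<forall>i\<in>{1..r}. \<forall>j<n. \<forall>c<b. coprime (f i) (g mod f i ^ \<tau> - monom (of_nat c) j)) \<longleftrightarrow>
      (\<forall>\<theta>. eval_ac \<theta> ?X = 0 \<longrightarrow> ?avoid \<theta>)"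
  proof -
    \<comment> \<open>Since \<open>\<tau> > 0\<close>, a root of \<open>f i\<close> is one of \<open>f i ^ \<tau>\<close>, so reduction preserves the value there.\<close>
    have "coprime (f i) (g mod f i ^ \<tau> - monom (of_nat c) j) \<longleftrightarrow>
        (\<forall>\<theta>. eval_ac \<theta> (f i) = 0 \<longrightarrow> eval_ac \<theta> g \<noteq> of_nat c * \<theta> ^ j)" for i j c
      using tau_pos by (auto simp: coprime_iff_no_common_root eval_ac_mod power_0_left)
    moreover have "eval_ac \<theta> ?X = 0 \<longleftrightarrow> (\<exists>i\<in>{1..r}. eval_ac \<theta> (f i) = 0)" for \<theta>
      unfolding assms(9) using tau_pos by (intro eval_ac_prod_power_eq_0_iff) auto
    ultimately show ?thesis
      by blast
  qed
  have S4: "(\<forall>\<theta> :: 'k alg_closure. poly (map_poly to_ac ?X) \<theta> = 0 \<longrightarrow>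
        poly (map_poly to_ac g) \<theta> \<notin> {of_nat c * \<theta> ^ j | c j. c < b \<and> j < n}) \<longleftrightarrow>
      (\<forall>\<theta>. eval_ac \<theta> ?X = 0 \<longrightarrow> ?avoid \<theta>)"
    unfolding eval_ac_def by blast
  show ?thesis
    unfolding Let_def S1 S2 S3 S4 by blast
qed

end
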